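(* For all integers $k\ge2$ and $l\ge2$ there is a graph isomorphism \[ L\{(x,y)\in\mathbb{Z}^2\,;\,0\le x+y\le k-1,\ 0\le x-y\le l-1\}\cong(P_k\times_K P_l)^o. \] Moreover, there is a graph isomorphism \[ L\{(x,y)\in\mathbb{Z}^2\,;\,x\ge y\ge -x\}\cong(\mathbb{Z}_+\times_K\mathbb{Z}_+)^o. \] Here the superscript $o$ denotes the connected component containing $o=(0,0)$.
   Context: Graphs are undirected, without loops or multiple edges. $\mathbb{Z}_+=\{0,1,2,\dots\}$ and the path $P_n$ (with vertex set $\{0,1,\dots,n-1\}$) are regarded as graphs in which two integers are adjacent if and only if they differ by exactly $1$. The Kronecker product $G_1\times_K G_2$ of graphs $G_1=(V_1,E_1)$ and $G_2=(V_2,E_2)$ is the graph on $V_1\times V_2$ with $(x,y)\sim(x',y')$ if and only if $x\sim x'$ in $G_1$ and $y\sim y'$ in $G_2$. The 2-dimensional integer lattice $\mathbb{Z}\times_C\mathbb{Z}$ is the graph on $\mathbb{Z}^2$ in which $(x,y)\sim(x',y')$ if and only if either $x'=x\pm1$ and $y'=y$, or $x'=x$ and $y'=y\pm1$. For $D\subset\mathbb{Z}^2$, $L[D]$ (also written $LD$ when $D$ is given in set-builder notation) denotes the induced subgraph of $\mathbb{Z}\times_C\mathbb{Z}$ spanned by the vertices in $D$. *)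

theory Defs
  imports Main
begin

text \<open>
  Undirected graphs without loops or multiple edges, possibly infinite: an edge between
  \<open>x\<close> and \<open>y\<close> is represented by the two ordered pairs \<open>(x, y)\<close> and \<open>(y, x)\<close>.
\<close>

record 'a ugraph =
  verts :: "'a set"
  edges :: "('a \<times> 'a) set"

definition simple_graph :: "'a ugraph \<Rightarrow> bool" where
  "simple_graph G \<longleftrightarrow> edges G \<subseteq> verts G \<times> verts G \<and> sym (edges G) \<and> irrefl (edges G)"

definition induced_subgraph :: "'a ugraph \<Rightarrow> 'a set \<Rightarrow> 'a ugraph" where
  "induced_subgraph G D =
     \<lparr>verts = verts G \<inter> D, edges = {(u, v) \<in> edges G. u \<in> D \<and> v \<in> D}\<rparr>"

definition component_of :: "'a ugraph \<Rightarrow> 'a \<Rightarrow> 'a ugraph" where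
  "component_of G v = induced_subgraph G {w. (v, w) \<in> (edges G)\<^sup>*}"

definition graph_isomorphism :: "('a \<Rightarrow> 'b) \<Rightarrow> 'a ugraph \<Rightarrow> 'b ugraph \<Rightarrow> bool" where
  "graph_isomorphism f G H \<longleftrightarrow>
     bij_betw f (verts G) (verts H) \<and>
     (\<forall>u\<in>verts G. \<forall>v\<in>verts G. (u, v) \<in> edges G \<longleftrightarrow> (f u, f v) \<in> edges H)"

definition isomorphic :: "'a ugraph \<Rightarrow> 'b ugraph \<Rightarrow> bool"  (infix "\<simeq>\<^sub>G" 50) where
  "G \<simeq>\<^sub>G H \<longleftrightarrow> (\<exists>f. graph_isomorphism f G H)"

definition kronecker_product :: "'a ugraph \<Rightarrow> 'b ugraph \<Rightarrow> ('a \<times> 'b) ugraph"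
    (infixr "\<times>\<^sub>K" 80) where
  "G \<times>\<^sub>K H =
     \<lparr>verts = verts G \<times> verts H,
      edges = {((x, y), (x', y')). (x, x') \<in> edges G \<and> (y, y') \<in> edges H}\<rparr>"

definition integer_graph :: "int set \<Rightarrow> int ugraph" where
  "integer_graph A = \<lparr>verts = A, edges = {(x, y). x \<in> A \<and> y \<in> A \<and> \<bar>x - y\<bar> = 1}\<rparr>"

definition path_graph :: "int \<Rightarrow> int ugraph" where
  "path_graph n = integer_graph {0..n - 1}"

definition half_line :: "int ugraph" where
  "half_line = integer_graph {0..}"

definition lattice_graph :: "(int \<times> int) ugraph" where
  "lattice_graph =
     \<lparr>verts = UNIV,
      edges = {((x, y), (x', y')).
        (x' = x + 1 \<or> x' = x - 1) \<and> y' = y \<or> x' = x \<and> (y' = y + 1 \<or> y' = y - 1)}\<rparr>"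

definition L :: "(int \<times> int) set \<Rightarrow> (int \<times> int) ugraph" where
  "L D = induced_subgraph lattice_graph D"

lemma simple_graph_induced_subgraph:
  "simple_graph G \<Longrightarrow> simple_graph (induced_subgraph G D)"
  by (auto simp: simple_graph_def induced_subgraph_def sym_def irrefl_def)

lemma simple_graph_component_of: "simple_graph G \<Longrightarrow> simple_graph (component_of G v)"
  by (simp add: component_of_def simple_graph_induced_subgraph)

lemma simple_graph_kronecker_product:
  "simple_graph G \<Longrightarrow> simple_graph H \<Longrightarrow> simple_graph (G \<times>\<^sub>K H)"
  by (auto simp: simple_graph_def kronecker_product_def sym_def irrefl_def)

lemma simple_graph_integer_graph: "simple_graph (integer_graph A)"
  by (auto simp: simple_graph_def integer_graph_def sym_def irrefl_def)

lemma simple_graph_path_graph: "simple_graph (path_graph n)"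
  by (simp add: path_graph_def simple_graph_integer_graph)

lemma simple_graph_half_line: "simple_graph half_line"
  by (simp add: half_line_def simple_graph_integer_graph)

lemma simple_graph_lattice_graph: "simple_graph lattice_graph"
  by (auto simp: simple_graph_def lattice_graph_def sym_def irrefl_def)

lemma simple_graph_L: "simple_graph (L D)"
  by (simp add: L_def simple_graph_induced_subgraph simple_graph_lattice_graph)

end

theory Submission imports Defs begin

text \<open>
  The isomorphism is the rotation \<open>(x, y) \<mapsto> (x + y, x - y)\<close> of the plane by 45 degrees (up to
  scaling and a reflection). It turns a unit step in a coordinate direction into a diagonal step
  \<open>(\<plusminus>1, \<plusminus>1)\<close>, which is an edge of a Kronecker product of integer graphs, and it maps the integer
  points bijectively onto the points \<open>(a, b)\<close> with \<open>a + b\<close> even. So what has to be known is that the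
  component of the origin in the Kronecker product consists of exactly the points with \<open>a + b\<close> even
  (lemma \<open>component_kronecker_integer_graph_iff\<close>). Diagonal steps preserve the parity of
  \<open>a + b\<close>; conversely, an even point can be moved to the origin by going down the diagonal until it
  meets an axis and then zigzagging along that axis, inside the strip of width 1 next to it.

  The hypothesis \<open>k, l \<ge> 2\<close> enters through the zigzag, which uses that both factors contain \<open>1\<close>. Paths
  and the half-line are treated together, as integer graphs on initial segments of the nonnegative
  integers.
\<close>

lemma edges_kronecker_integer_graph:
  "((a, b), (a', b')) \<in> edges (integer_graph A \<times>\<^sub>K integer_graph B) \<longleftrightarrow>
     a \<in> A \<and> a' \<in> A \<and> b \<in> B \<and> b' \<in> B \<and> \<bar>a - a'\<bar> = 1 \<and> \<bar>b - b'\<bar> = 1"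
  by (auto simp: kronecker_product_def integer_graph_def)

definition initial_segment :: "int set \<Rightarrow> bool" where
  "initial_segment A \<longleftrightarrow> A \<subseteq> {0..} \<and> (\<forall>a\<in>A. {0..a} \<subseteq> A)"

lemma initial_segmentD:
  "initial_segment A \<Longrightarrow> a \<in> A \<Longrightarrow> 0 \<le> a"
  "initial_segment A \<Longrightarrow> a \<in> A \<Longrightarrow> 0 \<le> a' \<Longrightarrow> a' \<le> a \<Longrightarrow> a' \<in> A"
  by (force simp: initial_segment_def)+

text \<open>
  The two coordinates change by an odd amount each, so their sum keeps its parity. The membership
  part records that a walk in the product never leaves its vertex set.
\<close>

lemma reachable_imp_even_sum:
  assumes "((0, 0), p) \<in> (edges (integer_graph A \<times>\<^sub>K integer_graph B))\<^sup>*" "0 \<in> A" "0 \<in> B"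
  shows "fst p \<in> A \<and> snd p \<in> B \<and> even (fst p + snd p)"
  using assms(1)
proof (induction rule: rtrancl_induct)
  case base
  then show ?case using assms(2,3) by simp
next
  case (step q r)
  obtain a b a' b' where qr: "q = (a, b)" "r = (a', b')"
    by (metis surj_pair)
  have e: "a' \<in> A" "b' \<in> B" "\<bar>a - a'\<bar> = 1" "\<bar>b - b'\<bar> = 1" "even (a + b)"
    using step by (auto simp: qr edges_kronecker_integer_graph)
  then have "even (a' + b')"
    by presburger
  with e show ?case
    by (simp add: qr)
qed

text \<open>
  Induction on \<open>a + b\<close>: off the axes the diagonal predecessor is available. On an axis it is
  not, but then the nonzero coordinate is at least 2 by parity, and two edges forming a zigzag
  through height 1 come from the point two steps closer to the origin.
\<close>

lemma even_sum_imp_reachable: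
  assumes seg: "initial_segment A" "initial_segment B" and one: "1 \<in> A" "1 \<in> B"
    and "a \<in> A" "b \<in> B" "even (a + b)"
  shows "((0, 0), (a, b)) \<in> (edges (integer_graph A \<times>\<^sub>K integer_graph B))\<^sup>*"
  using assms(5-7)
proof (induction "nat (a + b)" arbitrary: a b rule: less_induct)
  case less
  let ?E = "edges (integer_graph A \<times>\<^sub>K integer_graph B)"
  note A = initial_segmentD[OF seg(1)] and B = initial_segmentD[OF seg(2)]
  have nonneg: "0 \<le> a" "0 \<le> b"
    using A(1) B(1) less.prems by auto
  have zero: "0 \<in> A" "0 \<in> B"
    using A(2)[OF one(1)] B(2)[OF one(2)] by auto
  consider "a = 0" "b = 0" | "a > 0" "b > 0" | "a = 0" "b \<ge> 2" | "a \<ge> 2" "b = 0"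
    using nonneg \<open>even (a + b)\<close> by (smt (verit) odd_one)
  then show ?case
  proof cases
    case 1
    then show ?thesis by simp
  next
    case 2
    have mem: "a - 1 \<in> A" "b - 1 \<in> B"
      using 2 A(2)[OF less.prems(1)] B(2)[OF less.prems(2)] by auto
    have "((0, 0), (a - 1, b - 1)) \<in> ?E\<^sup>*"
      by (rule less.hyps) (use 2 mem less.prems(3) in auto)
    moreover have "((a - 1, b - 1), (a, b)) \<in> ?E"
      using mem less.prems by (simp add: edges_kronecker_integer_graph)
    ultimately show ?thesis
      by (rule rtrancl_into_rtrancl)
  next
    case 3
    have mem: "b - 1 \<in> B" "b - 2 \<in> B"
      using 3 B(2)[OF less.prems(2)] by auto
    have "((0, 0), (0, b - 2)) \<in> ?E\<^sup>*"
      by (rule less.hyps) (use 3 mem zero less.prems(3) in auto)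
    moreover have "((0, b - 2), (1, b - 1)) \<in> ?E" "((1, b - 1), (a, b)) \<in> ?E"
      using 3 mem zero one less.prems by (simp_all add: edges_kronecker_integer_graph)
    ultimately show ?thesis
      by (meson rtrancl_into_rtrancl)
  next
    case 4
    have mem: "a - 1 \<in> A" "a - 2 \<in> A"
      using 4 A(2)[OF less.prems(1)] by auto
    have "((0, 0), (a - 2, 0)) \<in> ?E\<^sup>*"
      by (rule less.hyps) (use 4 mem zero less.prems(3) in auto)
    moreover have "((a - 2, 0), (a - 1, 1)) \<in> ?E" "((a - 1, 1), (a, b)) \<in> ?E"
      using 4 mem zero one less.prems by (simp_all add: edges_kronecker_integer_graph)
    ultimately show ?thesis
      by (meson rtrancl_into_rtrancl)
  qed
qed

lemma component_kronecker_integer_graph_iff: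
  assumes "initial_segment A" "initial_segment B" "1 \<in> A" "1 \<in> B"
  shows "((0, 0), (a, b)) \<in> (edges (integer_graph A \<times>\<^sub>K integer_graph B))\<^sup>* \<longleftrightarrow>
           a \<in> A \<and> b \<in> B \<and> even (a + b)"
proof -
  have "0 \<in> A" "0 \<in> B"
    using assms initial_segmentD(2)[of _ 1 0] by auto
  then show ?thesis
    using reachable_imp_even_sum[of "(a, b)" A B] even_sum_imp_reachable[OF assms] by auto
qed

lemma component_kronecker_integer_graph:
  assumes "initial_segment A" "initial_segment B" "1 \<in> A" "1 \<in> B"
  shows "component_of (integer_graph A \<times>\<^sub>K integer_graph B) (0, 0) =
    induced_subgraph (integer_graph A \<times>\<^sub>K integer_graph B) {(a, b). even (a + b)}"
proof -
  have reach: "{w. ((0, 0), w) \<in> (edges (integer_graph A \<times>\<^sub>K integer_graph B))\<^sup>*} =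
      {(a, b). a \<in> A \<and> b \<in> B \<and> even (a + b)}"
    using component_kronecker_integer_graph_iff[OF assms] by auto
  show ?thesis
    unfolding component_of_def reach
    by (auto simp: induced_subgraph_def kronecker_product_def integer_graph_def)
qed

text \<open>
  A unit step along one axis changes \<open>x + y\<close> and \<open>x - y\<close> by \<open>\<plusminus>1\<close> each. Conversely, the four sign
  choices for these two changes are exactly the four lattice directions, because
  \<open>x\<close> and \<open>y\<close> are half the sum and half the difference of \<open>x + y\<close> and \<open>x - y\<close>.
\<close>

lemma lattice_edge_iff_diagonal:
  "((x, y), (x', y')) \<in> edges lattice_graph \<longleftrightarrow>
     \<bar>(x + y) - (x' + y')\<bar> = 1 \<and> \<bar>(x - y) - (x' - y')\<bar> = 1"
  by (simp add: lattice_graph_def) presburger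

text \<open>
  Surjectivity of the rotation onto the even points is where the parity condition enters: the
  preimage \<open>((a + b) / 2, (a - b) / 2)\<close> is integral exactly when \<open>a + b\<close> is even.
\<close>

lemma lattice_isomorphic_kronecker_component:
  assumes "initial_segment A" "initial_segment B" "1 \<in> A" "1 \<in> B"
  shows "L {(x, y). x + y \<in> A \<and> x - y \<in> B} \<simeq>\<^sub>G
         component_of (integer_graph A \<times>\<^sub>K integer_graph B) (0, 0)"
proof -
  let ?f = "\<lambda>(x, y). (x + y, x - y :: int)"
  let ?D = "{(x, y). x + y \<in> A \<and> x - y \<in> B}"
  let ?C = "{(a, b). a \<in> A \<and> b \<in> B \<and> even (a + b)}"
  let ?K = "component_of (integer_graph A \<times>\<^sub>K integer_graph B) (0, 0)"
  have vertsL: "verts (L ?D) = ?D"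
    by (simp add: L_def induced_subgraph_def lattice_graph_def)
  have vertsK: "verts ?K = ?C"
    unfolding component_kronecker_integer_graph[OF assms]
    by (auto simp: induced_subgraph_def kronecker_product_def integer_graph_def)
  have "bij_betw ?f ?D ?C"
  proof (rule bij_betw_byWitness[where f' = "\<lambda>(a, b). ((a + b) div 2, (a - b) div 2)"])
    have inv: "(a + b) div 2 + (a - b) div 2 = a" "(a + b) div 2 - (a - b) div 2 = b"
      if "even (a + b)" for a b :: int
      using that by presburger+
    show "\<forall>p\<in>?C. ?f (case p of (a, b) \<Rightarrow> ((a + b) div 2, (a - b) div 2)) = p"
      using inv by auto
    show "(\<lambda>(a, b). ((a + b) div 2, (a - b) div 2)) ` ?C \<subseteq> ?D"
      using inv by auto
  qed auto
  moreover have "(u, v) \<in> edges (L ?D) \<longleftrightarrow> (?f u, ?f v) \<in> edges ?K"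
    if "u \<in> ?D" "v \<in> ?D" for u v
    using that unfolding component_kronecker_integer_graph[OF assms]
    by (auto simp: L_def induced_subgraph_def
        lattice_edge_iff_diagonal edges_kronecker_integer_graph)
  ultimately have "graph_isomorphism ?f (L ?D) ?K"
    unfolding graph_isomorphism_def vertsL vertsK by blast
  then show ?thesis
    unfolding isomorphic_def by blast
qed

theorem theorem4p4:
  shows "(\<forall>k l :: int. k \<ge> 2 \<longrightarrow> l \<ge> 2 \<longrightarrow>
            L {(x, y). 0 \<le> x + y \<and> x + y \<le> k - 1 \<and> 0 \<le> x - y \<and> x - y \<le> l - 1}
              \<simeq>\<^sub>G component_of (path_graph k \<times>\<^sub>K path_graph l) (0, 0))
       \<and> L {(x, y). x \<ge> y \<and> y \<ge> - x} \<simeq>\<^sub>G component_of (half_line \<times>\<^sub>K half_line) (0, 0)"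
proof (intro conjI allI impI)
  fix k l :: int
  assume "k \<ge> 2" "l \<ge> 2"
  then have "L {(x, y). x + y \<in> {0..k - 1} \<and> x - y \<in> {0..l - 1}} \<simeq>\<^sub>G
      component_of (path_graph k \<times>\<^sub>K path_graph l) (0, 0)"
    unfolding path_graph_def
    by (intro lattice_isomorphic_kronecker_component) (auto simp: initial_segment_def)
  then show "L {(x, y). 0 \<le> x + y \<and> x + y \<le> k - 1 \<and> 0 \<le> x - y \<and> x - y \<le> l - 1} \<simeq>\<^sub>G
      component_of (path_graph k \<times>\<^sub>K path_graph l) (0, 0)"
    by (simp add: conj_assoc)
next
  have "L {(x, y). x + y \<in> {0..} \<and> x - y \<in> {0..}} \<simeq>\<^sub>G
      component_of (half_line \<times>\<^sub>K half_line) (0, 0)"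
    unfolding half_line_def
    by (intro lattice_isomorphic_kronecker_component) (auto simp: initial_segment_def)
  moreover have "{(x, y). x + y \<in> {0..} \<and> x - y \<in> {0..}} = {(x, y :: int). x \<ge> y \<and> y \<ge> - x}"
    by auto
  ultimately show "L {(x, y). x \<ge> y \<and> y \<ge> - x} \<simeq>\<^sub>G
      component_of (half_line \<times>\<^sub>K half_line) (0, 0)"
    by simp
qed

end
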